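(* Let $\mathcal{H}$ and $\mathcal{G}_i$, $i=1,\ldots,m$, be real Hilbert spaces, $A:\mathcal{H}\to2^{\mathcal{H}}$ maximally monotone, and $C:\mathcal{H}\to\mathcal{H}$ monotone and $\mu$-Lipschitzian for some $\mu>0$. Let $z\in\mathcal{H}$ and, for every $i\in\{1,\ldots,m\}$, let $r_i\in\mathcal{G}_i$, let $B_i:\mathcal{G}_i\to2^{\mathcal{G}_i}$ be maximally monotone and let $L_i:\mathcal{H}\to\mathcal{G}_i$ be a nonzero linear continuous operator. Suppose that $A+C$ is $\rho$-strongly monotone with $\rho>0$, and let $(\overline{x},\overline{v}_1,\ldots,\overline{v}_m)\in\mathcal{H}\times\mathcal{G}_1\times\cdots\times\mathcal{G}_m$ be a primal-dual solution, i.e. $$z-\sum_{i=1}^mL_i^*\overline{v}_i\in A\overline{x}+C\overline{x}\quad\text{and}\quad\overline{v}_i\in B_i(L_i\overline{x}-r_i),\ i=1,\ldots,m.$$ Let $x_0\in\mathcal{H}$, $(v_{1,0},\ldots,v_{m,0})\in\mathcal{G}_1\times\cdots\times\mathcal{G}_m$, $$\gamma_0\in\Big(0,\min\Big\{1,\frac{\sqrt{1+4\rho}}{2(1+2\rho)\mu}\Big\}\Big),\qquad\sigma_0=\frac{1}{2\gamma_0(1+2\rho)\sum_{i=1}^m\|L_i\|^2},$$ and define for all $n\ge0$ (and all $i=1,\ldots,m$) $$\begin{aligned} p_{1,n}&=J_{\gamma_nA}\Big(x_n-\gamma_n\Big(Cx_n+\sum_{i=1}^mL_i^*v_{i,n}-z\Big)\Big),\\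 p_{2,i,n}&=J_{\sigma_nB_i^{-1}}\big(v_{i,n}+\sigma_n(L_ix_n-r_i)\big),\\ v_{i,n+1}&=\sigma_nL_i(p_{1,n}-x_n)+p_{2,i,n},\\ x_{n+1}&=\gamma_n\sum_{i=1}^mL_i^*(v_{i,n}-p_{2,i,n})+\gamma_n(Cx_n-Cp_{1,n})+p_{1,n},\\ \theta_n&=\frac{1}{\sqrt{1+2\rho\gamma_n(1-\gamma_n)}},\quad\gamma_{n+1}=\theta_n\gamma_n,\quad\sigma_{n+1}=\frac{\sigma_n}{\theta_n}. \end{aligned}$$ Then for every $n\ge0$ $$\|x_n-\overline{x}\|^2+\gamma_n\sum_{i=1}^m\frac{\|v_{i,n}-\overline{v}_i\|^2}{\sigma_n}\le\gamma_n^2\Big(\frac{\|x_0-\overline{x}\|^2}{\gamma_0^2}+\sum_{i=1}^m\frac{\|v_{i,0}-\overline{v}_i\|^2}{\gamma_0\sigma_0}\Big).$$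
   Context: A set-valued operator $M:\mathcal{H}\to2^{\mathcal{H}}$ is monotone if $\langle x-y,u-v\rangle\ge0$ for all $u\in Mx$, $v\in My$; maximally monotone if its graph is not properly contained in the graph of another monotone operator; $\rho$-strongly monotone ($\rho>0$) if $\langle x-y,u-v\rangle\ge\rho\|x-y\|^2$ for all $u\in Mx$, $v\in My$. $C$ is $\mu$-Lipschitzian if it is single-valued with $\|Cx-Cy\|\le\mu\|x-y\|$. $M^{-1}(u)=\{x:u\in Mx\}$; $J_M=(\mathrm{Id}+M)^{-1}$ is the resolvent, single-valued and everywhere defined for maximally monotone $M$. $L_i^*$ is the adjoint of $L_i$. *)

theory Defs
  imports "HOL-Analysis.Analysis" "HOL-Library.Set_Algebras"
begin

text \<open>
  A set-valued operator is a function into sets, identified with its graph.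
  To allow finitely many different Hilbert spaces, each one is a closed
  subspace \<open>S\<close> of an ambient Hilbert space; up to isometry every
  finite family arises this way inside its direct sum.  An operator on \<open>S\<close>
  is then one whose graph lies in \<open>S \<times> S\<close>, so it has empty values
  outside \<open>S\<close>.
\<close>

definition op_graph :: "('a \<Rightarrow> 'a set) \<Rightarrow> ('a \<times> 'a) set" where
  "op_graph M = {(x, u). u \<in> M x}"

definition op_inverse :: "('a \<Rightarrow> 'a set) \<Rightarrow> 'a \<Rightarrow> 'a set" where
  "op_inverse M u = {x. u \<in> M x}"

definition op_scale :: "real \<Rightarrow> ('a::real_vector \<Rightarrow> 'a set) \<Rightarrow> 'a \<Rightarrow> 'a set" where
  "op_scale c M x = (\<lambda>u. c *\<^sub>R u) ` M x"

definition monotone_op :: "('a::real_inner \<Rightarrow> 'a set) \<Rightarrow> bool" where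
  "monotone_op M \<longleftrightarrow> (\<forall>x y. \<forall>u\<in>M x. \<forall>v\<in>M y. 0 \<le> inner (x - y) (u - v))"

definition strongly_monotone_op :: "real \<Rightarrow> ('a::real_inner \<Rightarrow> 'a set) \<Rightarrow> bool" where
  "strongly_monotone_op \<rho> M \<longleftrightarrow>
     (\<forall>x y. \<forall>u\<in>M x. \<forall>v\<in>M y. \<rho> * (norm (x - y))\<^sup>2 \<le> inner (x - y) (u - v))"

definition maximally_monotone_on :: "'a::real_inner set \<Rightarrow> ('a \<Rightarrow> 'a set) \<Rightarrow> bool" where
  "maximally_monotone_on S M \<longleftrightarrow>
     op_graph M \<subseteq> S \<times> S \<and> monotone_op M \<and>
     \<not> (\<exists>N. op_graph N \<subseteq> S \<times> S \<and> monotone_op N \<and> op_graph M \<subset> op_graph N)"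

text \<open>
  The sum \<open>{p} + M p\<close> is the sum of sets, so this is
  \<open>(Id + M)\<^sup>-\<^sup>1\<close>, read as a function by picking the unique element.
  If \<open>M\<close> is an operator on a subspace \<open>S\<close>, any such \<open>p\<close> lies in
  \<open>S\<close>, since \<open>M p\<close> is nonempty.
\<close>

definition resolvent :: "('a::real_inner \<Rightarrow> 'a set) \<Rightarrow> 'a \<Rightarrow> 'a" where
  "resolvent M x = (THE p. p \<in> op_inverse (\<lambda>y. {y} + M y) x)"

end

theory Submission
  imports Defs
begin

text \<open>
  Write \<open>V n\<close> for \<open>\<Sum>i. (norm (v i n - vbar i))\<^sup>2\<close>.  The weighted
  distance to the solution
  \<open>(norm (x n - xbar))\<^sup>2 / (\<gamma> n)\<^sup>2 + V n / (\<gamma> n * \<sigma> n)\<close>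
  does not increase with \<open>n\<close>; multiplying by \<open>(\<gamma> n)\<^sup>2\<close>
  gives the claim.

  One iteration is a forward-backward-forward step in the product space.  Strong
  monotonicity of \<open>A + C\<close>, tested between the backward point \<open>p1\<close> and
  \<open>xbar\<close>, and monotonicity of \<open>B i\<close>, tested between \<open>p2 i\<close> and
  \<open>vbar i\<close>, add up to an inequality in which the coupling terms with
  \<open>L i\<close> cancel.  The remaining inner products are differences of squared
  distances, so the iterate approaches the solution up to the distances between
  backward points and new iterates.  These errors are at most a constant times the
  distances between backward points and old iterates, and the bounds on
  \<open>\<gamma>\<close> and on the invariant product \<open>\<gamma> n * \<sigma> n\<close> are what
  makes the latter pay for them.  The gain from strong monotonicity, however, is
  measured at \<open>p1\<close>; carrying it over to the new iterate costs the factor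
  \<open>1 - \<gamma>\<close> that appears in \<open>\<theta>\<close>.  The outcome is
  \<open>primal_dual_step\<close>, whose left-hand factor is \<open>1 / (\<theta> n)\<^sup>2\<close>,
  that is, the quotient of the squares of two consecutive steps \<open>\<gamma>\<close>.

  Using it requires that adjoints really satisfy the adjoint identity
  (\<open>adjoint_inner\<close>) and that resolvents really solve their inclusions
  (\<open>resolvent_inclusion\<close>, from Minty's theorem).  Both are existence results
  in a Hilbert space, and both follow from the existence of minimizers of
  convex functions with a quadratic term (\<open>strongly_convex_minimizer\<close>):
  for the Riesz representation the function is minus the given functional, for
  Minty's theorem it is the Fitzpatrick function of the operator.
\<close>

section \<open>Minimizing strongly convex functions\<close>

text \<open>
  The set \<open>E\<close> plays the role of the epigraph of a convex lower semicontinuous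
  function \<open>f\<close> with values in \<open>(-\<infinity>, \<infinity>]\<close>, so that no
  extended reals are needed, and \<open>f + (norm w)\<^sup>2 / 2\<close> is minimized.  By the parallelogram
  identity every minimizing sequence is Cauchy, hence convergent in norm by
  completeness, and its limit stays in the closed set \<open>E\<close>.  The second conclusion is the
  first-order condition: \<open>- w0\<close> is a subgradient of \<open>f\<close> at \<open>w0\<close>.
\<close>

lemma strongly_convex_minimizer:
  fixes E :: "('a::{real_inner,complete_space} \<times> real) set"
  assumes "convex E" "closed E" "E \<noteq> {}"
    and lower: "\<And>w t. (w, t) \<in> E \<Longrightarrow> \<beta> \<le> t + (norm w)\<^sup>2 / 2"
  obtains w0 t0 where "(w0, t0) \<in> E"
    and "\<And>w t. (w, t) \<in> E \<Longrightarrow> t0 + (norm w0)\<^sup>2 \<le> t + inner w0 w"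
proof -
  define \<phi> :: "'a \<times> real \<Rightarrow> real" where "\<phi> = (\<lambda>(w, t). t + (norm w)\<^sup>2 / 2)"
  define I where "I = Inf (\<phi> ` E)"
  have bdd: "bdd_below (\<phi> ` E)"
    using lower by (intro bdd_belowI[of _ \<beta>]) (auto simp: \<phi>_def)
  have I_le: "I \<le> \<phi> e" if "e \<in> E" for e
    using that bdd by (auto simp: I_def intro: cInf_lower)
  have "\<exists>e\<in>E. \<phi> e < I + 1 / real (Suc n)" for n
    using cInf_less_iff[of "\<phi> ` E" "I + 1 / real (Suc n)"] bdd \<open>E \<noteq> {}\<close>
    by (auto simp: I_def)
  then obtain e where e: "\<And>n. e n \<in> E" "\<And>n. \<phi> (e n) < I + 1 / real (Suc n)"
    by metis
  define w where "w n = fst (e n)" for n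
  define t where "t n = snd (e n)" for n
  have e_eq: "e n = (w n, t n)" for n
    by (simp add: w_def t_def)
  have gap: "(norm (w i - w j))\<^sup>2 \<le> 4 / real (Suc i) + 4 / real (Suc j)" for i j
  proof -
    have "(1/2) *\<^sub>R e i + (1/2) *\<^sub>R e j \<in> E"
      using \<open>convex E\<close> e(1) by (intro convexD) auto
    then have "I \<le> \<phi> ((1/2) *\<^sub>R e i + (1/2) *\<^sub>R e j)"
      by (rule I_le)
    also have "\<dots> = \<phi> (e i) / 2 + \<phi> (e j) / 2 - (norm (w i - w j))\<^sup>2 / 8"
      unfolding e_eq \<phi>_def power2_norm_eq_inner
      by (simp add: inner_simps inner_commute field_simps)
    finally show ?thesis
      using e(2)[of i] e(2)[of j] by simp
  qed
  have "Cauchy w"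
  proof (rule metric_CauchyI)
    fix \<epsilon> :: real assume "0 < \<epsilon>"
    then obtain N where N: "inverse (real (Suc N)) < \<epsilon>\<^sup>2 / 8"
      using reals_Archimedean[of "\<epsilon>\<^sup>2 / 8"] by auto
    have "dist (w i) (w j) < \<epsilon>" if "N \<le> i" "N \<le> j" for i j
    proof -
      have "1 / real (Suc i) \<le> inverse (real (Suc N))" "1 / real (Suc j) \<le> inverse (real (Suc N))"
        using that by (auto simp: field_simps)
      with gap[of i j] N have "(norm (w i - w j))\<^sup>2 < \<epsilon>\<^sup>2"
        by simp
      then show ?thesis
        using \<open>0 < \<epsilon>\<close> by (auto simp: dist_norm intro: power2_less_imp_less)
    qed
    then show "\<exists>M. \<forall>i\<ge>M. \<forall>j\<ge>M. dist (w i) (w j) < \<epsilon>" by blast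
  qed
  then obtain w0 where w0: "w \<longlonglongrightarrow> w0"
    using Cauchy_convergent convergent_def by blast
  have "(\<lambda>n. \<phi> (e n)) \<longlonglongrightarrow> I"
  proof (rule tendsto_sandwich)
    show "\<forall>\<^sub>F n in sequentially. I \<le> \<phi> (e n)" using I_le e(1) by simp
    show "\<forall>\<^sub>F n in sequentially. \<phi> (e n) \<le> I + inverse (real (Suc n))"
      using e(2) by (intro always_eventually allI) (simp add: less_imp_le inverse_eq_divide)
    show "(\<lambda>n. I + inverse (real (Suc n))) \<longlonglongrightarrow> I"
      using tendsto_add[OF tendsto_const LIMSEQ_inverse_real_of_nat, of I] by simp
  qed simp
  then have "(\<lambda>n. \<phi> (e n) - (norm (w n))\<^sup>2 / 2) \<longlonglongrightarrow> I - (norm w0)\<^sup>2 / 2"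
    by (intro tendsto_intros w0) auto
  then have t0: "t \<longlonglongrightarrow> I - (norm w0)\<^sup>2 / 2"
    by (simp add: \<phi>_def e_eq)
  define t0 where "t0 = I - (norm w0)\<^sup>2 / 2"
  have "e \<longlonglongrightarrow> (w0, t0)"
    using tendsto_Pair[OF w0 t0] by (simp add: e_eq[abs_def] t0_def)
  then have mem: "(w0, t0) \<in> E"
    using \<open>closed E\<close> e(1) closed_sequentially by blast
  moreover have "t0 + (norm w0)\<^sup>2 \<le> t + inner w0 w" if wt: "(w, t) \<in> E" for w t
  proof -
    \<comment> \<open>\<open>D\<close> is the first-order term of the objective along the segment from the
      minimizer to \<open>(w, t)\<close>; letting the segment parameter tend to \<open>0\<close>
      shows that it is nonnegative.\<close>
    define D where "D = t - t0 + inner w0 (w - w0)"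
    have "0 \<le> D + s * ((norm (w - w0))\<^sup>2 / 2)" if s: "0 < s" "s \<le> 1" for s
    proof -
      have "(1 - s) *\<^sub>R (w0, t0) + s *\<^sub>R (w, t) \<in> E"
        using \<open>convex E\<close> mem wt s by (intro convexD) auto
      then have "I \<le> \<phi> ((1 - s) *\<^sub>R (w0, t0) + s *\<^sub>R (w, t))"
        by (rule I_le)
      also have "\<dots> = I + s * (D + s * ((norm (w - w0))\<^sup>2 / 2))"
        unfolding \<phi>_def D_def t0_def power2_norm_eq_inner
        by (simp add: inner_simps inner_commute field_simps power2_eq_square)
      finally have "0 \<le> s * (D + s * ((norm (w - w0))\<^sup>2 / 2))" by simp
      then show ?thesis using s by (simp add: zero_le_mult_iff)
    qed
    then have "\<forall>\<^sub>F s in at_right 0. 0 \<le> D + s * ((norm (w - w0))\<^sup>2 / 2)"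
      using eventually_at_right_less[of "0::real"]
      by (auto simp: eventually_at_right[of 0 1] intro!: exI[of _ 1])
    moreover have "((\<lambda>s. D + s * ((norm (w - w0))\<^sup>2 / 2)) \<longlongrightarrow> D + 0 * ((norm (w - w0))\<^sup>2 / 2)) (at_right 0)"
      by (intro tendsto_intros)
    ultimately have "0 \<le> D + 0 * ((norm (w - w0))\<^sup>2 / 2)"
      by (intro tendsto_lowerbound[OF _ _ trivial_limit_at_right_real])
    then show ?thesis
      by (simp add: D_def inner_simps power2_norm_eq_inner)
  qed
  ultimately show thesis by (rule that)
qed

section \<open>Riesz representation and adjoints\<close>

text \<open>
  Take \<open>E\<close> to be the graph of \<open>- f\<close>.  The first-order condition bounds the
  linear functional \<open>inner w0 x - f x\<close> from below, hence it vanishes.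
\<close>

lemma riesz_representation:
  fixes f :: "'a::{real_inner,complete_space} \<Rightarrow> real"
  assumes "bounded_linear f"
  obtains w where "\<And>x. f x = inner w x"
proof -
  interpret bounded_linear f by fact
  obtain K where K: "\<And>x. norm (f x) \<le> norm x * K"
    using bounded by blast
  define E where "E = {(x, t). t = - f x}"
  have "convex E"
    by (auto simp: E_def convex_def add scaleR)
  moreover have "closed E"
    unfolding E_def case_prod_unfold
    by (intro closed_Collect_eq continuous_intros continuous_on)
  moreover have "E \<noteq> {}" by (auto simp: E_def)
  moreover have "- K\<^sup>2 / 2 \<le> t + (norm x)\<^sup>2 / 2" if "(x, t) \<in> E" for x t
  proof -
    have "f x \<le> norm x * K" using K[of x] by simp
    moreover have "0 \<le> (norm x - K)\<^sup>2" by simp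
    ultimately show ?thesis
      using that by (simp add: E_def power2_eq_square algebra_simps)
  qed
  ultimately obtain w0 t0 where
    w0: "\<And>x t. (x, t) \<in> E \<Longrightarrow> t0 + (norm w0)\<^sup>2 \<le> t + inner w0 x"
    using strongly_convex_minimizer[of E "- K\<^sup>2 / 2"] by metis
  define c where "c = t0 + (norm w0)\<^sup>2"
  have lb: "c \<le> inner w0 x - f x" for x
    using w0[of x "- f x"] by (simp add: E_def c_def)
  \<comment> \<open>If \<open>d\<close> is a nonzero value of the functional, scaling its argument produces the
    value \<open>c - 1\<close>, below the lower bound.\<close>
  have "f x = inner w0 x" for x
  proof (rule ccontr)
    define d where "d = inner w0 x - f x"
    assume "f x \<noteq> inner w0 x"
    then have "d \<noteq> 0" by (simp add: d_def)
    have "c \<le> ((c - 1) / d) * d"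
      using lb[of "((c - 1) / d) *\<^sub>R x"] by (simp add: d_def scaleR right_diff_distrib)
    with \<open>d \<noteq> 0\<close> show False by simp
  qed
  then show thesis by (rule that)
qed

text \<open>
  The constant \<open>adjoint\<close> is a choice among the maps with this property, so the
  point is that such a map exists; by Riesz it does when the domain is a
  Hilbert space.
\<close>

lemma adjoint_inner:
  fixes f :: "'a::{real_inner,complete_space} \<Rightarrow> 'b::real_inner"
  assumes "bounded_linear f"
  shows "inner x (adjoint f y) = inner (f x) y"
proof -
  have "\<exists>w. \<forall>x. inner (f x) y = inner x w" for y
  proof -
    have "bounded_linear (\<lambda>x. inner (f x) y)"
      by (rule bounded_linear_compose[OF bounded_linear_inner_left assms])
    then show ?thesis
      by (metis riesz_representation inner_commute)
  qed
  then have "\<exists>f'. \<forall>x y. inner (f x) y = inner x (f' y)" by metis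
  then have "\<forall>x y. inner (f x) y = inner x (adjoint f y)"
    unfolding adjoint_def by (rule someI_ex)
  then show ?thesis by simp
qed

section \<open>Resolvents of maximally monotone operators\<close>

text \<open>
  A pair that is monotonically related to the whole graph belongs to it, since
  adding it would give a monotone extension.  This is the form in which maximality
  is used, because it behaves well under translation, scaling and inversion.
\<close>

lemma maximally_monotone_onD:
  assumes M: "maximally_monotone_on S M" and "x \<in> S" "u \<in> S"
    and rel: "\<And>a b. b \<in> M a \<Longrightarrow> 0 \<le> inner (x - a) (u - b)"
  shows "u \<in> M x"
proof (rule ccontr)
  assume u: "u \<notin> M x"
  define N where "N = (\<lambda>y. if y = x then insert u (M x) else M y)"
  have rel': "0 \<le> inner (a - x) (b - u)" if "b \<in> M a" for a b
    using rel[OF that] by (simp add: inner_simps)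
  have "op_graph N \<subseteq> S \<times> S"
    using M \<open>x \<in> S\<close> \<open>u \<in> S\<close>
    unfolding maximally_monotone_on_def op_graph_def N_def subset_iff by (auto split: if_splits)
  moreover have "monotone_op N"
    using M rel rel'
    by (auto simp: maximally_monotone_on_def monotone_op_def N_def)
  moreover have "op_graph M \<subset> op_graph N"
    using u by (auto simp: op_graph_def N_def psubset_eq set_eq_iff)
  ultimately show False
    using M by (auto simp: maximally_monotone_on_def)
qed

lemma maximally_monotone_on_inverse:
  assumes "maximally_monotone_on S M"
  shows "maximally_monotone_on S (op_inverse M)"
proof -
  have mono: "monotone_op (op_inverse M)"
    using assms unfolding maximally_monotone_on_def monotone_op_def op_inverse_def
    by (metis inner_commute mem_Collect_eq)
  have "op_graph N \<subseteq> op_graph (op_inverse M)"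
    if N: "op_graph N \<subseteq> S \<times> S" "monotone_op N" "op_graph (op_inverse M) \<subseteq> op_graph N" for N
  proof clarify
    fix u x assume "(u, x) \<in> op_graph N"
    then have "x \<in> N u" "u \<in> S" "x \<in> S" using N(1) by (auto simp: op_graph_def)
    moreover have "0 \<le> inner (x - a) (u - b)" if "b \<in> M a" for a b
    proof -
      have "a \<in> N b" using that N(3) by (auto simp: op_graph_def op_inverse_def)
      then show ?thesis
        using N(2) \<open>x \<in> N u\<close> by (auto simp: monotone_op_def inner_commute)
    qed
    ultimately have "u \<in> M x" using maximally_monotone_onD[OF assms] by blast
    then show "(u, x) \<in> op_graph (op_inverse M)" by (simp add: op_graph_def op_inverse_def)
  qed
  then show ?thesis
    using assms mono by (auto simp: maximally_monotone_on_def op_graph_def op_inverse_def)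
qed

text \<open>
  Minty's theorem at the origin: \<open>0\<close> is in the range of \<open>Id + M\<close>, where
  \<open>M\<close> is the operator with graph \<open>R\<close>.  The set \<open>E\<close> in the proof is
  the epigraph of its Fitzpatrick function
  \<open>F (x, u) = Sup {inner x b + inner a u - inner a b | (a, b) \<in> R}\<close>.
  Monotonicity says that \<open>F (a, b)\<close> is at most \<open>inner a b\<close> on
  \<open>R\<close>, and maximality that \<open>F (x, u)\<close> is at least
  \<open>inner x u\<close> everywhere.  Hence \<open>F (x, u) + (norm (x, u))\<^sup>2 / 2\<close> is at
  least \<open>(norm (x + u))\<^sup>2 / 2\<close> and in particular nonnegative.  For its minimizer
  \<open>(x, u)\<close> the first-order condition, evaluated on \<open>R\<close>, shows that
  \<open>(- u, - x)\<close> is monotonically related to \<open>R\<close> with excess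
  \<open>(norm (x + u))\<^sup>2\<close>.  By maximality this pair lies in \<open>R\<close>;
  comparing it with itself shows that the excess is \<open>0\<close>, so \<open>u = - x\<close>.
\<close>

lemma minty_origin:
  fixes S :: "'a::{real_inner,complete_space} set"
  assumes S: "subspace S" "closed S" and R: "R \<subseteq> S \<times> S"
    and mono: "\<And>a b a' b'. (a, b) \<in> R \<Longrightarrow> (a', b') \<in> R \<Longrightarrow> 0 \<le> inner (a - a') (b - b')"
    and max: "\<And>x u. x \<in> S \<Longrightarrow> u \<in> S \<Longrightarrow> (\<And>a b. (a, b) \<in> R \<Longrightarrow> 0 \<le> inner (x - a) (u - b))
                \<Longrightarrow> (x, u) \<in> R"
  obtains p where "(p, - p) \<in> R"
proof -
  define E where "E = {((x, u), t). x \<in> S \<and> u \<in> S \<and>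
    (\<forall>(a, b)\<in>R. inner x b + inner a u - inner a b \<le> t)}"
  have ER: "((a, b), inner a b) \<in> E" if "(a, b) \<in> R" for a b
  proof -
    have "inner a b' + inner a' b - inner a' b' \<le> inner a b" if "(a', b') \<in> R" for a' b'
      using mono[OF \<open>(a, b) \<in> R\<close> that] by (simp add: inner_simps)
    then show ?thesis using R that by (auto simp: E_def)
  qed
  have above: "inner x u \<le> t" if E: "((x, u), t) \<in> E" for x u t
  proof (rule ccontr)
    assume less: "\<not> inner x u \<le> t"
    have rel: "0 < inner (x - a) (u - b)" if "(a, b) \<in> R" for a b
      using E that less by (fastforce simp: E_def inner_simps)
    then have "(x, u) \<in> R" using E less_imp_le by (intro max) (auto simp: E_def)
    from rel[OF this] show False by simp
  qed
  have square: "(norm (x, u))\<^sup>2 = (norm x)\<^sup>2 + (norm u)\<^sup>2" for x u :: 'a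
    by (simp add: norm_Pair)
  have "convex E"
  proof (rule convexI)
    fix e f :: "('a \<times> 'a) \<times> real" and s t :: real
    assume "e \<in> E" "f \<in> E" and st: "0 \<le> s" "0 \<le> t" "s + t = 1"
    obtain x u c where e: "e = ((x, u), c)" by (metis prod.exhaust)
    obtain y v d where f: "f = ((y, v), d)" by (metis prod.exhaust)
    have "inner (s *\<^sub>R x + t *\<^sub>R y) b + inner a (s *\<^sub>R u + t *\<^sub>R v) - inner a b \<le> s * c + t * d"
      if "(a, b) \<in> R" for a b
    proof -
      have "s * (inner x b + inner a u - inner a b) \<le> s * c"
        "t * (inner y b + inner a v - inner a b) \<le> t * d"
        using \<open>e \<in> E\<close> \<open>f \<in> E\<close> that st by (auto simp: E_def e f intro!: mult_left_mono)
      moreover have "inner a b = s * inner a b + t * inner a b"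
        using st(3) by (metis distrib_right mult_1)
      ultimately show ?thesis by (simp add: inner_simps algebra_simps)
    qed
    then show "s *\<^sub>R e + t *\<^sub>R f \<in> E"
      using \<open>e \<in> E\<close> \<open>f \<in> E\<close> S(1)
      by (auto simp: E_def e f subspace_add subspace_scale)
  qed
  moreover have "closed E"
  proof -
    have "E = ((S \<times> S) \<times> UNIV) \<inter>
      (\<Inter>(a, b)\<in>R. {e. inner (fst (fst e)) b + inner a (snd (fst e)) - inner a b \<le> snd e})"
      by (auto simp: E_def)
    moreover have "closed \<dots>"
      using S(2)
      by (auto intro!: closed_Int closed_Times closed_INT closed_Collect_le continuous_intros)
    ultimately show ?thesis by simp
  qed
  moreover have "E \<noteq> {}"
  proof -
    have "R \<noteq> {}" using max[of 0 0] S(1) subspace_0 by blast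
    then show ?thesis using ER by fast
  qed
  moreover have "0 \<le> t + (norm w)\<^sup>2 / 2" if "(w, t) \<in> E" for w t
  proof -
    obtain x u where w: "w = (x, u)" by (metis prod.exhaust)
    have "0 \<le> (norm (x + u))\<^sup>2 / 2" by simp
    also have "\<dots> = inner x u + (norm w)\<^sup>2 / 2"
      unfolding w square power2_norm_eq_inner by (simp add: inner_simps inner_commute field_simps)
    also have "\<dots> \<le> t + (norm w)\<^sup>2 / 2" using above that w by simp
    finally show ?thesis .
  qed
  ultimately obtain w0 t0 where E0: "(w0, t0) \<in> E"
    and min: "\<And>w t. (w, t) \<in> E \<Longrightarrow> t0 + (norm w0)\<^sup>2 \<le> t + inner w0 w"
    using strongly_convex_minimizer[of E 0] by metis
  obtain x u where w0: "w0 = (x, u)" by (metis prod.exhaust)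
  have "inner x u \<le> t0" using above E0 w0 by simp
  have sep: "(norm (x + u))\<^sup>2 \<le> inner (- u - a) (- x - b)" if "(a, b) \<in> R" for a b
  proof -
    have "t0 + (norm x)\<^sup>2 + (norm u)\<^sup>2 \<le> inner a b + inner x a + inner u b"
      using min[OF ER[OF that]] by (simp add: w0 square)
    with \<open>inner x u \<le> t0\<close> show ?thesis
      by (simp add: power2_norm_eq_inner inner_simps inner_commute)
  qed
  have "(- u, - x) \<in> R"
  proof (rule max)
    show "- u \<in> S" "- x \<in> S"
      using E0 S(1) by (auto simp: E_def w0 subspace_neg)
    show "0 \<le> inner (- u - a) (- x - b)" if "(a, b) \<in> R" for a b
      using sep[OF that] zero_le_power2 order_trans by blast
  qed
  from sep[OF this] have "u = - x" by (simp add: add_eq_0_iff)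
  with \<open>(- u, - x) \<in> R\<close> show thesis by (intro that[of x]) simp
qed

text \<open>
  The element described by \<open>resolvent\<close> is unique by monotonicity, and it exists
  by Minty's theorem applied to the graph of \<open>c M - y\<close>, which is again maximally
  monotone.
\<close>

lemma resolvent_inclusion:
  fixes S :: "'a::{real_inner,complete_space} set"
  assumes S: "subspace S" "closed S" and M: "maximally_monotone_on S M"
    and "0 < c" "y \<in> S"
  defines "p \<equiv> resolvent (op_scale c M) y"
  shows "(1 / c) *\<^sub>R (y - p) \<in> M p"
proof -
  have graph: "a \<in> S \<and> b \<in> S" if "b \<in> M a" for a b
    using M that by (auto simp: maximally_monotone_on_def op_graph_def)
  have mono: "0 \<le> inner (a - a') (b - b')" if "b \<in> M a" "b' \<in> M a'" for a b a' b'
    using M that by (auto simp: maximally_monotone_on_def monotone_op_def)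
  have iff: "q \<in> op_inverse (\<lambda>q. {q} + op_scale c M q) y \<longleftrightarrow> (1 / c) *\<^sub>R (y - q) \<in> M q" for q
  proof -
    have "y = q + c *\<^sub>R b \<longleftrightarrow> b = (1 / c) *\<^sub>R (y - q)" for b
      using \<open>0 < c\<close> by (auto simp: eq_vector_fraction_iff algebra_simps)
    then show ?thesis
      by (auto simp: op_inverse_def op_scale_def set_plus_def)
  qed
  have "\<exists>q. (1 / c) *\<^sub>R (y - q) \<in> M q"
  proof -
    define R where "R = {(a, d). (1 / c) *\<^sub>R (d + y) \<in> M a}"
    have "R \<subseteq> S \<times> S"
    proof clarify
      fix a d assume "(a, d) \<in> R"
      then have "a \<in> S" "(1 / c) *\<^sub>R (d + y) \<in> S" using graph by (auto simp: R_def)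
      then have "c *\<^sub>R ((1 / c) *\<^sub>R (d + y)) - y \<in> S"
        using subspace_diff[OF S(1) subspace_scale[OF S(1)] \<open>y \<in> S\<close>] by blast
      then show "a \<in> S \<and> d \<in> S" using \<open>a \<in> S\<close> \<open>0 < c\<close> by simp
    qed
    moreover have "0 \<le> inner (a - a') (d - d')" if "(a, d) \<in> R" "(a', d') \<in> R" for a d a' d'
    proof -
      have "0 \<le> inner (a - a') ((1 / c) *\<^sub>R (d + y) - (1 / c) *\<^sub>R (d' + y))"
        using that mono by (simp add: R_def)
      also have "\<dots> = inner (a - a') (d - d') / c"
        by (simp flip: scaleR_diff_right)
      finally show ?thesis using \<open>0 < c\<close> by (simp add: zero_le_divide_iff)
    qed
    moreover have "(a, d) \<in> R" if "a \<in> S" "d \<in> S"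
      and rel: "\<And>a' d'. (a', d') \<in> R \<Longrightarrow> 0 \<le> inner (a - a') (d - d')" for a d
    proof -
      have "(1 / c) *\<^sub>R (d + y) \<in> M a"
      proof (rule maximally_monotone_onD[OF M \<open>a \<in> S\<close>])
        show "(1 / c) *\<^sub>R (d + y) \<in> S"
          using S(1) that \<open>y \<in> S\<close> by (intro subspace_scale subspace_add)
        fix a' b' assume "b' \<in> M a'"
        then have "0 \<le> inner (a - a') (d - (c *\<^sub>R b' - y))"
          using \<open>0 < c\<close> by (intro rel) (simp add: R_def)
        also have "d - (c *\<^sub>R b' - y) = c *\<^sub>R ((1 / c) *\<^sub>R (d + y) - b')"
          using \<open>0 < c\<close> by (simp add: algebra_simps)
        finally show "0 \<le> inner (a - a') ((1 / c) *\<^sub>R (d + y) - b')"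
          using \<open>0 < c\<close> by (simp add: zero_le_mult_iff)
      qed
      then show ?thesis by (simp add: R_def)
    qed
    ultimately obtain q where "(q, - q) \<in> R"
      using minty_origin[OF S, of R] by metis
    then show ?thesis by (auto simp: R_def)
  qed
  moreover have "q = q'" if "(1 / c) *\<^sub>R (y - q) \<in> M q" "(1 / c) *\<^sub>R (y - q') \<in> M q'" for q q'
  proof -
    have "0 \<le> inner (q - q') ((1 / c) *\<^sub>R (y - q) - (1 / c) *\<^sub>R (y - q'))"
      using that mono by blast
    also have "(1 / c) *\<^sub>R (y - q) - (1 / c) *\<^sub>R (y - q') = (- 1 / c) *\<^sub>R (q - q')"
      by (simp add: algebra_simps)
    also have "inner (q - q') \<dots> = - (norm (q - q'))\<^sup>2 / c"
      by (simp add: power2_norm_eq_inner)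
    finally have "(norm (q - q'))\<^sup>2 \<le> 0" using \<open>0 < c\<close> by (simp add: field_simps)
    then show ?thesis by simp
  qed
  ultimately have "\<exists>!q. q \<in> op_inverse (\<lambda>q. {q} + op_scale c M q) y"
    unfolding iff by blast
  then have "p \<in> op_inverse (\<lambda>q. {q} + op_scale c M q) y"
    unfolding p_def resolvent_def by (rule theI')
  then show ?thesis by (simp add: iff)
qed

section \<open>One primal-dual step\<close>

lemma two_inner_diff:
  fixes a b c p :: "'a::real_inner"
  shows "2 * inner (p - c) (a - b)
    = (norm (a - c))\<^sup>2 - (norm (b - c))\<^sup>2 - (norm (a - p))\<^sup>2 + (norm (b - p))\<^sup>2"
  unfolding power2_norm_eq_inner by (simp add: inner_simps inner_commute)

lemma norm_add_squared_le:
  fixes a b :: "'a::real_inner"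
  shows "(norm (a + b))\<^sup>2 \<le> 2 * (norm a)\<^sup>2 + 2 * (norm b)\<^sup>2"
proof -
  have "0 \<le> (norm (a - b))\<^sup>2" by simp
  then show ?thesis
    unfolding power2_norm_eq_inner by (simp add: inner_simps inner_commute)
qed

text \<open>
  Young's inequality with the weights arranged so that, for \<open>s = \<gamma>\<close> and
  \<open>b\<close> a forward correction, the coefficient of \<open>(norm (a + b))\<^sup>2\<close> is the
  expression \<open>\<gamma> (1 - \<gamma>)\<close> in the step-size rule.
\<close>

lemma norm_add_squared_le_weighted:
  fixes a b :: "'a::real_inner"
  assumes "0 < s" "s < 1"
  shows "s * (1 - s) * (norm (a + b))\<^sup>2 \<le> s * (norm a)\<^sup>2 + (1 - s) * (norm b)\<^sup>2"
proof -
  have "0 \<le> (norm (s *\<^sub>R a - (1 - s) *\<^sub>R b))\<^sup>2" by simp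
  also have "\<dots> = s * (norm a)\<^sup>2 + (1 - s) * (norm b)\<^sup>2 - s * (1 - s) * (norm (a + b))\<^sup>2"
    unfolding power2_norm_eq_inner
    by (simp add: inner_simps inner_commute algebra_simps power2_eq_square)
  finally show ?thesis by simp
qed

text \<open>
  Pairing the sum \<open>y\<close> with itself moves the adjoints back to
  \<open>L i y\<close>, which is bounded by the operator norm of \<open>L i\<close>; the rest is
  Cauchy-Schwarz for finite sums.
\<close>

lemma norm_sum_adjoint_squared_le:
  fixes L :: "'i \<Rightarrow> 'a::{real_inner,complete_space} \<Rightarrow> 'b::real_inner"
  assumes L: "\<And>i. i \<in> J \<Longrightarrow> bounded_linear (L i)"
  shows "(norm (\<Sum>i\<in>J. adjoint (L i) (w i)))\<^sup>2
    \<le> (\<Sum>i\<in>J. (onorm (L i))\<^sup>2) * (\<Sum>i\<in>J. (norm (w i))\<^sup>2)"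
    (is "(norm ?y)\<^sup>2 \<le> ?\<Lambda> * ?W")
proof -
  have "(norm ?y)\<^sup>2 = (\<Sum>i\<in>J. inner (L i ?y) (w i))"
    unfolding power2_norm_eq_inner inner_sum_right[of ?y]
    by (intro sum.cong refl adjoint_inner L)
  also have "\<dots> \<le> (\<Sum>i\<in>J. onorm (L i) * norm ?y * norm (w i))"
    using L by (intro sum_mono order_trans[OF norm_cauchy_schwarz] mult_right_mono onorm) auto
  also have "\<dots> = norm ?y * (\<Sum>i\<in>J. onorm (L i) * norm (w i))"
    by (simp add: sum_distrib_left mult_ac)
  finally have "norm ?y * norm ?y \<le> norm ?y * (\<Sum>i\<in>J. onorm (L i) * norm (w i))"
    by (simp add: power2_eq_square)
  moreover have "0 \<le> (\<Sum>i\<in>J. onorm (L i) * norm (w i))"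
    using L by (intro sum_nonneg mult_nonneg_nonneg onorm_pos_le) auto
  ultimately have "norm ?y \<le> (\<Sum>i\<in>J. onorm (L i) * norm (w i))"
    by (cases "norm ?y = 0") (auto simp: mult_le_cancel_left)
  then have "(norm ?y)\<^sup>2 \<le> (\<Sum>i\<in>J. onorm (L i) * norm (w i))\<^sup>2"
    by (intro power_mono) auto
  also have "\<dots> \<le> ?\<Lambda> * ?W"
    by (rule Cauchy_Schwarz_ineq_sum)
  finally show ?thesis .
qed

text \<open>
  Here \<open>p\<close> and \<open>q\<close> are the backward points, \<open>c\<close> and \<open>d\<close> stand for
  the values of the Lipschitz operator at \<open>x\<close> and \<open>p\<close>, and \<open>x'\<close>,
  \<open>v'\<close> are the new iterates.  The operators enter only through the assumptions
  \<open>primal\<close> and \<open>dual\<close>, the monotonicity inequalities between the backward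
  points and the solution \<open>(xb, vb)\<close>.  The two step-size conditions are those under which
  \<open>1 + 2 * \<rho>\<close> times the primal error \<open>(norm (x' - p))\<^sup>2\<close>, together with the dual
  error, is absorbed by the negative terms: the factor \<open>1\<close> comes from
  the distance identity and \<open>2 * \<rho>\<close> from moving the strong
  monotonicity gain from \<open>p\<close> to \<open>x'\<close>.
\<close>

lemma primal_dual_step:
  fixes L :: "'i \<Rightarrow> 'a::{real_inner,complete_space} \<Rightarrow> 'b::real_inner"
    and x xb p c d z :: 'a and v vb q r :: "'i \<Rightarrow> 'b"
    and J :: "'i set" and \<gamma> \<sigma> \<rho> \<mu> :: real
  defines "x' \<equiv> \<gamma> *\<^sub>R (\<Sum>i\<in>J. adjoint (L i) (v i - q i)) + \<gamma> *\<^sub>R (c - d) + p"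
    and "v' \<equiv> \<lambda>i. \<sigma> *\<^sub>R L i (p - x) + q i"
    and "\<Lambda> \<equiv> (\<Sum>i\<in>J. (onorm (L i))\<^sup>2)"
  assumes L: "\<And>i. i \<in> J \<Longrightarrow> bounded_linear (L i)"
    and pos: "0 < \<gamma>" "\<gamma> < 1" "0 < \<sigma>" "0 < \<rho>"
    and primal: "\<rho> * (norm (p - xb))\<^sup>2 \<le> inner (p - xb)
      ((1 / \<gamma>) *\<^sub>R (x - \<gamma> *\<^sub>R (c + (\<Sum>i\<in>J. adjoint (L i) (v i)) - z) - p) + d
        - (z - (\<Sum>i\<in>J. adjoint (L i) (vb i))))"
    and dual: "\<And>i. i \<in> J \<Longrightarrow> 0 \<le> inner (q i - vb i)
      ((1 / \<sigma>) *\<^sub>R (v i + \<sigma> *\<^sub>R (L i x - r i) - q i) - (L i xb - r i))"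
    and lip: "norm (c - d) \<le> \<mu> * norm (x - p)"
    and step_dual: "2 * (1 + 2 * \<rho>) * \<gamma> * \<sigma> * \<Lambda> \<le> 1"
    and step_primal: "2 * (1 + 2 * \<rho>) * \<gamma>\<^sup>2 * \<mu>\<^sup>2 + \<gamma> * \<sigma> * \<Lambda> \<le> 1"
  shows "(1 + 2 * \<rho> * \<gamma> * (1 - \<gamma>)) * (norm (x' - xb))\<^sup>2 + \<gamma> / \<sigma> * (\<Sum>i\<in>J. (norm (v' i - vb i))\<^sup>2)
    \<le> (norm (x - xb))\<^sup>2 + \<gamma> / \<sigma> * (\<Sum>i\<in>J. (norm (v i - vb i))\<^sup>2)"
proof -
  have lin: "L i (a - b) = L i a - L i b" if "i \<in> J" for i a b
    using L[OF that] by (simp add: bounded_linear.linear linear_diff)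
  define w where "w = p - xb"
  have adj: "inner w (\<Sum>i\<in>J. adjoint (L i) (u i)) = (\<Sum>i\<in>J. inner (L i w) (u i))" for u
    unfolding inner_sum_right by (intro sum.cong refl adjoint_inner L)
  \<comment> \<open>Rewriting both monotonicity inequalities in terms of the new iterates leaves the
    coupling term \<open>inner (L i w) (q i - vb i)\<close> with opposite signs in
    \<open>P\<close> and \<open>D\<close>.\<close>
  have P: "\<gamma> * \<rho> * (norm w)\<^sup>2 \<le> inner w (x - x') - \<gamma> * (\<Sum>i\<in>J. inner (L i w) (q i - vb i))"
  proof -
    have "\<gamma> * (\<rho> * (norm w)\<^sup>2) \<le> \<gamma> * inner w
      ((1 / \<gamma>) *\<^sub>R (x - \<gamma> *\<^sub>R (c + (\<Sum>i\<in>J. adjoint (L i) (v i)) - z) - p) + d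
        - (z - (\<Sum>i\<in>J. adjoint (L i) (vb i))))"
      using primal pos by (intro mult_left_mono) (auto simp: w_def)
    also have "\<dots> = inner w (x - p) - \<gamma> * inner w (c - d)
        - \<gamma> * ((\<Sum>i\<in>J. inner (L i w) (v i)) - (\<Sum>i\<in>J. inner (L i w) (vb i)))"
      using pos by (simp add: inner_add_right inner_diff_right adj algebra_simps)
    also have "\<dots> = inner w (x - x') - \<gamma> * (\<Sum>i\<in>J. inner (L i w) (q i - vb i))"
      by (simp add: x'_def inner_add_right inner_diff_right adj sum_subtractf algebra_simps)
    finally show ?thesis by simp
  qed
  have D: "- \<gamma> * inner (L i w) (q i - vb i) \<le> \<gamma> / \<sigma> * inner (q i - vb i) (v i - v' i)" if i: "i \<in> J" for i
  proof -
    have "(1 / \<sigma>) *\<^sub>R (v i + \<sigma> *\<^sub>R (L i x - r i) - q i) - (L i xb - r i)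
      = (1 / \<sigma>) *\<^sub>R (v i - v' i) + L i w"
      using pos by (simp add: v'_def w_def lin[OF i] algebra_simps)
    with dual[OF i] have "0 \<le> inner (q i - vb i) (v i - v' i) / \<sigma> + inner (q i - vb i) (L i w)"
      by (simp add: inner_add_right)
    then have "0 \<le> \<gamma> * (inner (q i - vb i) (v i - v' i) / \<sigma> + inner (q i - vb i) (L i w))"
      using pos by (intro mult_nonneg_nonneg) auto
    then show ?thesis by (simp add: distrib_left inner_commute[of "L i w"])
  qed
  have "2 * \<gamma> * \<rho> * (norm w)\<^sup>2
    \<le> 2 * inner w (x - x') + \<gamma> / \<sigma> * (\<Sum>i\<in>J. 2 * inner (q i - vb i) (v i - v' i))"
  proof -
    have "- \<gamma> * (\<Sum>i\<in>J. inner (L i w) (q i - vb i)) \<le> \<gamma> / \<sigma> * (\<Sum>i\<in>J. inner (q i - vb i) (v i - v' i))"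
      unfolding sum_distrib_left using D by (intro sum_mono) auto
    moreover have "\<gamma> / \<sigma> * (\<Sum>i\<in>J. 2 * inner (q i - vb i) (v i - v' i))
      = 2 * (\<gamma> / \<sigma> * (\<Sum>i\<in>J. inner (q i - vb i) (v i - v' i)))"
      by (simp flip: sum_distrib_left)
    ultimately show ?thesis using P by linarith
  qed
  also have "\<dots> = (norm (x - xb))\<^sup>2 - (norm (x' - xb))\<^sup>2 - (norm (x - p))\<^sup>2 + (norm (x' - p))\<^sup>2
    + \<gamma> / \<sigma> * ((\<Sum>i\<in>J. (norm (v i - vb i))\<^sup>2) - (\<Sum>i\<in>J. (norm (v' i - vb i))\<^sup>2)
      - (\<Sum>i\<in>J. (norm (v i - q i))\<^sup>2) + (\<Sum>i\<in>J. (norm (v' i - q i))\<^sup>2))"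
    unfolding w_def two_inner_diff by (simp add: sum_subtractf sum.distrib)
  finally have main: "2 * \<gamma> * \<rho> * (norm w)\<^sup>2 \<le> \<dots>" .
  \<comment> \<open>\<open>X\<close> and \<open>V\<close> occur with negative sign in \<open>main\<close>; the two positive
    error terms are estimated by them.\<close>
  define X where "X = (norm (x - p))\<^sup>2"
  define Y where "Y = (norm (x' - p))\<^sup>2"
  define V where "V = (\<Sum>i\<in>J. (norm (v i - q i))\<^sup>2)"
  have nonneg: "0 \<le> X" "0 \<le> Y" "0 \<le> V" by (auto simp: X_def Y_def V_def sum_nonneg)
  have dual_error: "\<gamma> / \<sigma> * (\<Sum>i\<in>J. (norm (v' i - q i))\<^sup>2) \<le> \<gamma> * \<sigma> * \<Lambda> * X"
  proof -
    have "(norm (v' i - q i))\<^sup>2 \<le> \<sigma>\<^sup>2 * X * (onorm (L i))\<^sup>2" if i: "i \<in> J" for i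
    proof -
      have "norm (v' i - q i) \<le> \<sigma> * (onorm (L i) * norm (x - p))"
        using onorm[OF L[OF i], of "p - x"] pos by (simp add: v'_def norm_minus_commute)
      then have "(norm (v' i - q i))\<^sup>2 \<le> (\<sigma> * (onorm (L i) * norm (x - p)))\<^sup>2"
        by (intro power_mono) auto
      then show ?thesis by (simp add: X_def power_mult_distrib mult_ac)
    qed
    then have "(\<Sum>i\<in>J. (norm (v' i - q i))\<^sup>2) \<le> \<sigma>\<^sup>2 * X * \<Lambda>"
      unfolding \<Lambda>_def sum_distrib_left by (rule sum_mono)
    then have "\<gamma> / \<sigma> * (\<Sum>i\<in>J. (norm (v' i - q i))\<^sup>2) \<le> \<gamma> / \<sigma> * (\<sigma>\<^sup>2 * X * \<Lambda>)"
      using pos by (intro mult_left_mono) auto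
    then show ?thesis using pos by (simp add: power2_eq_square mult_ac)
  qed
  have primal_error: "Y \<le> 2 * \<gamma>\<^sup>2 * \<Lambda> * V + 2 * \<gamma>\<^sup>2 * \<mu>\<^sup>2 * X"
  proof -
    have "Y = \<gamma>\<^sup>2 * (norm ((\<Sum>i\<in>J. adjoint (L i) (v i - q i)) + (c - d)))\<^sup>2"
      unfolding Y_def x'_def by (simp flip: scaleR_add_right add: power_mult_distrib)
    also have "\<dots> \<le> \<gamma>\<^sup>2 * (2 * (\<Lambda> * V) + 2 * (\<mu>\<^sup>2 * X))"
    proof (intro mult_left_mono order_trans[OF norm_add_squared_le] add_mono)
      show "(norm (\<Sum>i\<in>J. adjoint (L i) (v i - q i)))\<^sup>2 \<le> \<Lambda> * V"
        unfolding \<Lambda>_def V_def by (rule norm_sum_adjoint_squared_le[OF L])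
      show "(norm (c - d))\<^sup>2 \<le> \<mu>\<^sup>2 * X"
        using power_mono[OF lip, of 2] by (simp add: X_def power_mult_distrib)
    qed auto
    finally show ?thesis by (simp add: algebra_simps)
  qed
  have transfer: "\<gamma> * (1 - \<gamma>) * (norm (x' - xb))\<^sup>2 \<le> \<gamma> * (norm w)\<^sup>2 + (1 - \<gamma>) * Y"
    using norm_add_squared_le_weighted[OF pos(1,2), of w "x' - p"] by (simp add: w_def Y_def)
  have absorbed: "(1 + 2 * \<rho>) * Y \<le> (1 - \<gamma> * \<sigma> * \<Lambda>) * X + \<gamma> / \<sigma> * V"
  proof -
    have "(1 + 2 * \<rho>) * Y \<le> (1 + 2 * \<rho>) * (2 * \<gamma>\<^sup>2 * \<Lambda> * V + 2 * \<gamma>\<^sup>2 * \<mu>\<^sup>2 * X)"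
      using primal_error pos by (intro mult_left_mono) auto
    also have "\<dots> = (2 * (1 + 2 * \<rho>) * \<gamma> * \<sigma> * \<Lambda>) * (\<gamma> / \<sigma> * V) + (2 * (1 + 2 * \<rho>) * \<gamma>\<^sup>2 * \<mu>\<^sup>2) * X"
      using pos by (simp add: field_simps power2_eq_square)
    also have "\<dots> \<le> 1 * (\<gamma> / \<sigma> * V) + (1 - \<gamma> * \<sigma> * \<Lambda>) * X"
      using step_dual step_primal nonneg pos by (intro add_mono mult_right_mono) auto
    finally show ?thesis by simp
  qed
  have "2 * \<rho> * (\<gamma> * (1 - \<gamma>) * (norm (x' - xb))\<^sup>2) \<le> 2 * \<rho> * (\<gamma> * (norm w)\<^sup>2 + (1 - \<gamma>) * Y)"
    using transfer pos by (intro mult_left_mono) auto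
  moreover have "2 * \<rho> * ((1 - \<gamma>) * Y) \<le> 2 * \<rho> * Y"
    using pos nonneg by (intro mult_left_mono mult_left_le_one_le) auto
  ultimately have "2 * \<rho> * \<gamma> * (1 - \<gamma>) * (norm (x' - xb))\<^sup>2 \<le> 2 * \<gamma> * \<rho> * (norm w)\<^sup>2 + 2 * \<rho> * Y"
    by (simp add: algebra_simps)
  with main absorbed dual_error show ?thesis
    unfolding X_def[symmetric] Y_def[symmetric] V_def[symmetric] by (simp add: algebra_simps)
qed

section \<open>The accelerated algorithm\<close>

theorem theorem3p1:
  fixes m :: nat
    and G :: "nat \<Rightarrow> 'g::{real_inner, complete_space} set"
    and A :: "'h::{real_inner, complete_space} \<Rightarrow> 'h set"
    and C :: "'h \<Rightarrow> 'h"
    and B :: "nat \<Rightarrow> 'g \<Rightarrow> 'g set"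
    and L :: "nat \<Rightarrow> 'h \<Rightarrow> 'g"
    and z xbar :: 'h
    and r vbar :: "nat \<Rightarrow> 'g"
    and \<mu> \<rho> :: real
    and x p1 :: "nat \<Rightarrow> 'h"
    and v p2 :: "nat \<Rightarrow> nat \<Rightarrow> 'g"
    and \<gamma> \<sigma> \<theta> :: "nat \<Rightarrow> real"
  assumes "1 \<le> m"
    and "\<And>i. i \<in> {1..m} \<Longrightarrow> subspace (G i) \<and> closed (G i)"
    and "maximally_monotone_on UNIV A"
    and "monotone_op (\<lambda>y. {C y})"
    and "0 < \<mu>" and "\<mu>-lipschitz_on UNIV C"
    and "\<And>i. i \<in> {1..m} \<Longrightarrow> r i \<in> G i"
    and "\<And>i. i \<in> {1..m} \<Longrightarrow> maximally_monotone_on (G i) (B i)"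
    and "\<And>i. i \<in> {1..m} \<Longrightarrow>
           bounded_linear (L i) \<and> range (L i) \<subseteq> G i \<and> L i \<noteq> (\<lambda>_. 0)"
    and "0 < \<rho>" and "strongly_monotone_op \<rho> (\<lambda>y. A y + {C y})"
    and "\<And>i. i \<in> {1..m} \<Longrightarrow> vbar i \<in> G i"
    and "z - (\<Sum>i=1..m. adjoint (L i) (vbar i)) \<in> A xbar + {C xbar}"
    and "\<And>i. i \<in> {1..m} \<Longrightarrow> vbar i \<in> B i (L i xbar - r i)"
    and "\<And>i. i \<in> {1..m} \<Longrightarrow> v i 0 \<in> G i"
    and "0 < \<gamma> 0" and "\<gamma> 0 < min 1 (sqrt (1 + 4 * \<rho>) / (2 * (1 + 2 * \<rho>) * \<mu>))"
    and "\<sigma> 0 = 1 / (2 * \<gamma> 0 * (1 + 2 * \<rho>) * (\<Sum>i=1..m. (onorm (L i))\<^sup>2))"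
    and "\<And>n. p1 n = resolvent (op_scale (\<gamma> n) A)
           (x n - \<gamma> n *\<^sub>R (C (x n) + (\<Sum>i=1..m. adjoint (L i) (v i n)) - z))"
    and "\<And>n i. i \<in> {1..m} \<Longrightarrow> p2 i n = resolvent (op_scale (\<sigma> n) (op_inverse (B i)))
           (v i n + \<sigma> n *\<^sub>R (L i (x n) - r i))"
    and "\<And>n i. i \<in> {1..m} \<Longrightarrow> v i (Suc n) = \<sigma> n *\<^sub>R L i (p1 n - x n) + p2 i n"
    and "\<And>n. x (Suc n) = \<gamma> n *\<^sub>R (\<Sum>i=1..m. adjoint (L i) (v i n - p2 i n))
           + \<gamma> n *\<^sub>R (C (x n) - C (p1 n)) + p1 n"
    and "\<And>n. \<theta> n = 1 / sqrt (1 + 2 * \<rho> * \<gamma> n * (1 - \<gamma> n))"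
    and "\<And>n. \<gamma> (Suc n) = \<theta> n * \<gamma> n"
    and "\<And>n. \<sigma> (Suc n) = \<sigma> n / \<theta> n"
  shows "\<forall>n. (norm (x n - xbar))\<^sup>2 + \<gamma> n * (\<Sum>i=1..m. (norm (v i n - vbar i))\<^sup>2 / \<sigma> n)
    \<le> (\<gamma> n)\<^sup>2 * ((norm (x 0 - xbar))\<^sup>2 / (\<gamma> 0)\<^sup>2
        + (\<Sum>i=1..m. (norm (v i 0 - vbar i))\<^sup>2 / (\<gamma> 0 * \<sigma> 0)))"
proof -
  note G_hyp = assms(2) and A_max = assms(3) and C_lip = assms(6) and r_mem = assms(7)
    and B_max = assms(8) and L_hyp = assms(9) and AC_strong = assms(11) and primal_sol = assms(13)
    and dual_sol = assms(14) and v0_mem = assms(15) and g0_pos = assms(16) and g0_less = assms(17)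
    and sigma0 = assms(18) and p1_def = assms(19) and p2_def = assms(20) and v_Suc = assms(21)
    and x_Suc = assms(22) and theta_def = assms(23) and gamma_Suc = assms(24) and sigma_Suc = assms(25)
  have G: "subspace (G i)" "closed (G i)" if "i \<in> {1..m}" for i
    using G_hyp[OF that] by auto
  have L: "bounded_linear (L i)" "\<And>y. L i y \<in> G i" if "i \<in> {1..m}" for i
    using L_hyp[OF that] by auto
  define \<Lambda> where "\<Lambda> = (\<Sum>i=1..m. (onorm (L i))\<^sup>2)"
  have "0 < \<Lambda>"
  proof -
    have "0 < (onorm (L 1))\<^sup>2"
      using L_hyp[of 1] \<open>1 \<le> m\<close> by (auto simp: onorm_eq_0)
    also have "\<dots> \<le> \<Lambda>"
      unfolding \<Lambda>_def using \<open>1 \<le> m\<close> by (intro member_le_sum) auto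
    finally show ?thesis .
  qed
  have \<gamma>0: "\<gamma> 0 < 1" "\<gamma> 0 < sqrt (1 + 4 * \<rho>) / (2 * (1 + 2 * \<rho>) * \<mu>)"
    using g0_less by auto
  \<comment> \<open>The product of the two step sizes is invariant, so its initial value makes the dual
    step condition an equality in every iteration; the primal one only improves as
    \<open>\<gamma> n\<close> decreases.\<close>
  have steps: "0 < \<gamma> n \<and> \<gamma> n \<le> \<gamma> 0 \<and> \<gamma> n * \<sigma> n = \<gamma> 0 * \<sigma> 0" for n
  proof (induction n)
    case 0
    show ?case using g0_pos by simp
  next
    case (Suc n)
    then have "1 \<le> 1 + 2 * \<rho> * \<gamma> n * (1 - \<gamma> n)"
      using \<gamma>0(1) \<open>0 < \<rho>\<close> by auto
    then have "0 < \<theta> n" "\<theta> n \<le> 1" by (auto simp: theta_def)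
    with Suc show ?case
      by (auto simp: gamma_Suc sigma_Suc intro: order_trans[OF mult_left_le_one_le])
  qed
  have \<gamma>_pos: "0 < \<gamma> n" and \<gamma>_less_1: "\<gamma> n < 1" for n
    using steps[of n] \<gamma>0 by auto
  have \<gamma>\<sigma>\<Lambda>: "2 * (1 + 2 * \<rho>) * \<gamma> n * \<sigma> n * \<Lambda> = 1" for n
  proof -
    have "2 * (1 + 2 * \<rho>) * (\<gamma> 0 * \<sigma> 0) * \<Lambda> = 1"
    proof -
      define d where "d = 2 * \<gamma> 0 * (1 + 2 * \<rho>) * \<Lambda>"
      have "0 < d"
        using \<open>0 < \<Lambda>\<close> \<gamma>_pos[of 0] \<open>0 < \<rho>\<close> by (simp add: d_def)
      moreover have "\<sigma> 0 = 1 / d"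
        unfolding sigma0 \<Lambda>_def d_def ..
      ultimately have "d * \<sigma> 0 = 1" by simp
      then show ?thesis by (simp only: d_def mult_ac)
    qed
    moreover have "\<gamma> n * \<sigma> n = \<gamma> 0 * \<sigma> 0" using steps by blast
    ultimately show ?thesis by (simp add: mult.assoc)
  qed
  have \<sigma>_pos: "0 < \<sigma> n" for n
  proof -
    have "0 < \<sigma> 0"
      using \<open>0 < \<Lambda>\<close> \<gamma>_pos[of 0] \<open>0 < \<rho>\<close> unfolding sigma0 \<Lambda>_def[symmetric] by simp
    then have "0 < \<gamma> n * \<sigma> n"
      using steps[of n] \<gamma>_pos[of 0] by simp
    then show ?thesis using \<gamma>_pos[of n] by (simp add: zero_less_mult_iff)
  qed
  have step_primal: "2 * (1 + 2 * \<rho>) * (\<gamma> n)\<^sup>2 * \<mu>\<^sup>2 + \<gamma> n * \<sigma> n * \<Lambda> \<le> 1" for n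
  proof -
    \<comment> \<open>As \<open>\<gamma> n * \<sigma> n * \<Lambda> = 1 / (2 * k)\<close>, the condition reads
      \<open>(2 * k * \<gamma> n * \<mu>)\<^sup>2 \<le> 2 * k - 1\<close>, and \<open>2 * k - 1 = 1 + 4 * \<rho>\<close>
      is the radicand in the bound on the initial step.\<close>
    define k where "k = 1 + 2 * \<rho>"
    have "0 < k" using \<open>0 < \<rho>\<close> by (simp add: k_def)
    have "\<gamma> n * (2 * k * \<mu>) \<le> \<gamma> 0 * (2 * k * \<mu>)"
      using steps[of n] \<open>0 < k\<close> \<open>0 < \<mu>\<close> by (intro mult_right_mono) auto
    also have "\<dots> \<le> sqrt (2 * k - 1)"
      using \<gamma>0(2) \<open>0 < k\<close> \<open>0 < \<mu>\<close> by (simp add: k_def pos_less_divide_eq less_imp_le)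
    finally have "(\<gamma> n * (2 * k * \<mu>))\<^sup>2 \<le> 2 * k - 1"
      using \<gamma>_pos[of n] \<open>0 < k\<close> \<open>0 < \<mu>\<close> \<open>0 < \<rho>\<close>
        power_mono[of "\<gamma> n * (2 * k * \<mu>)" "sqrt (2 * k - 1)" 2]
      by (simp add: k_def)
    moreover have "2 * k * (2 * k * (\<gamma> n)\<^sup>2 * \<mu>\<^sup>2) = (\<gamma> n * (2 * k * \<mu>))\<^sup>2"
      by (simp add: power2_eq_square mult_ac)
    moreover have "2 * k * (\<gamma> n * \<sigma> n * \<Lambda>) = 1"
      using \<gamma>\<sigma>\<Lambda>[of n] by (simp add: k_def mult_ac)
    ultimately have "2 * k * (2 * k * (\<gamma> n)\<^sup>2 * \<mu>\<^sup>2 + \<gamma> n * \<sigma> n * \<Lambda>) \<le> 2 * k * 1"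
      by (simp only: distrib_left)
    then show ?thesis using \<open>0 < k\<close> by (simp add: k_def)
  qed
  have p1: "(1 / \<gamma> n) *\<^sub>R (x n - \<gamma> n *\<^sub>R (C (x n) + (\<Sum>i=1..m. adjoint (L i) (v i n)) - z) - p1 n)
      \<in> A (p1 n)" for n
    unfolding p1_def[of n] using A_max \<gamma>_pos by (intro resolvent_inclusion[of UNIV]) auto
  have p2: "(1 / \<sigma> n) *\<^sub>R (v i n + \<sigma> n *\<^sub>R (L i (x n) - r i) - p2 i n) \<in> op_inverse (B i) (p2 i n)"
    if i: "i \<in> {1..m}" and "v i n \<in> G i" for i n
    unfolding p2_def[OF i, of n]
    using G[OF i] L(2)[OF i] r_mem[OF i] \<sigma>_pos that
      maximally_monotone_on_inverse[OF B_max[OF i]]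
    by (intro resolvent_inclusion[of "G i"] subspace_add subspace_scale subspace_diff) auto
  \<comment> \<open>Minty's theorem provides the resolvent of the inverse of \<open>B i\<close> at points of
    \<open>G i\<close>, so the dual iterates have to stay there.\<close>
  have v_mem: "v i n \<in> G i" if i: "i \<in> {1..m}" for i n
  proof (induction n)
    case 0
    show ?case using v0_mem[OF i] .
  next
    case (Suc n)
    have "p2 i n \<in> G i"
      using p2[OF i Suc] B_max[OF i]
      by (auto simp: maximally_monotone_on_def op_graph_def op_inverse_def)
    then show ?case
      unfolding v_Suc[OF i] using G[OF i] L(2)[OF i] by (intro subspace_add subspace_scale) auto
  qed
  define V where "V n = (\<Sum>i=1..m. (norm (v i n - vbar i))\<^sup>2)" for n
  have descent: "(1 + 2 * \<rho> * \<gamma> n * (1 - \<gamma> n)) * (norm (x (Suc n) - xbar))\<^sup>2 + \<gamma> n / \<sigma> n * V (Suc n)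
      \<le> (norm (x n - xbar))\<^sup>2 + \<gamma> n / \<sigma> n * V n" for n
  proof -
    have "V (Suc n) = (\<Sum>i=1..m. (norm (\<sigma> n *\<^sub>R L i (p1 n - x n) + p2 i n - vbar i))\<^sup>2)"
      unfolding V_def by (intro sum.cong refl) (simp add: v_Suc)
    moreover have "\<rho> * (norm (p1 n - xbar))\<^sup>2 \<le> inner (p1 n - xbar)
      ((1 / \<gamma> n) *\<^sub>R (x n - \<gamma> n *\<^sub>R (C (x n) + (\<Sum>i=1..m. adjoint (L i) (v i n)) - z) - p1 n)
        + C (p1 n) - (z - (\<Sum>i=1..m. adjoint (L i) (vbar i))))"
      using AC_strong primal_sol set_plus_intro[OF p1[of n], of "C (p1 n)" "{C (p1 n)}"]
      unfolding strongly_monotone_op_def by blast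
    moreover have "0 \<le> inner (p2 i n - vbar i)
      ((1 / \<sigma> n) *\<^sub>R (v i n + \<sigma> n *\<^sub>R (L i (x n) - r i) - p2 i n) - (L i xbar - r i))"
      if i: "i \<in> {1..m}" for i
      using maximally_monotone_on_inverse[OF B_max[OF i]] p2[OF i v_mem[OF i]] dual_sol[OF i]
      by (auto simp: maximally_monotone_on_def monotone_op_def op_inverse_def)
    moreover have "norm (C (x n) - C (p1 n)) \<le> \<mu> * norm (x n - p1 n)"
      using lipschitz_onD[OF C_lip, of "x n" "p1 n"] by (simp add: dist_norm)
    ultimately show ?thesis
      unfolding x_Suc[of n] V_def
      using primal_dual_step[of "{1..m}" L "\<gamma> n" "\<sigma> n" \<rho> "p1 n" xbar "x n" "C (x n)" "\<lambda>i. v i n" z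
          "C (p1 n)" vbar "\<lambda>i. p2 i n" r \<mu>]
        L(1) \<gamma>_pos \<gamma>_less_1 \<sigma>_pos \<open>0 < \<rho>\<close> step_primal[of n] \<gamma>\<sigma>\<Lambda>[of n]
      by (simp add: \<Lambda>_def)
  qed
  define \<Phi> where "\<Phi> n = (norm (x n - xbar))\<^sup>2 / (\<gamma> n)\<^sup>2 + V n / (\<gamma> n * \<sigma> n)" for n
  have "\<Phi> (Suc n) \<le> \<Phi> n" for n
  proof -
    define k where "k = 1 + 2 * \<rho> * \<gamma> n * (1 - \<gamma> n)"
    have "0 < k" using \<gamma>_pos[of n] \<gamma>_less_1[of n] \<open>0 < \<rho>\<close> by (simp add: k_def add_pos_pos)
    then have "(\<gamma> (Suc n))\<^sup>2 = (\<gamma> n)\<^sup>2 / k"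
      by (simp add: theta_def gamma_Suc k_def power_mult_distrib power_divide)
    moreover have "\<gamma> (Suc n) * \<sigma> (Suc n) = \<gamma> n * \<sigma> n"
      using steps by metis
    ultimately have "\<Phi> (Suc n)
      = (k * (norm (x (Suc n) - xbar))\<^sup>2 + \<gamma> n / \<sigma> n * V (Suc n)) / (\<gamma> n)\<^sup>2"
      using \<gamma>_pos[of n] \<sigma>_pos[of n] by (simp add: \<Phi>_def add_divide_distrib power2_eq_square mult_ac)
    also have "\<dots> \<le> ((norm (x n - xbar))\<^sup>2 + \<gamma> n / \<sigma> n * V n) / (\<gamma> n)\<^sup>2"
      using descent[of n] by (intro divide_right_mono) (auto simp: k_def)
    also have "\<dots> = \<Phi> n"
      using \<gamma>_pos[of n] \<sigma>_pos[of n] by (simp add: \<Phi>_def add_divide_distrib power2_eq_square mult_ac)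
    finally show ?thesis .
  qed
  then have "\<Phi> n \<le> \<Phi> 0" for n
    by (rule lift_Suc_antimono_le) simp
  then have "(\<gamma> n)\<^sup>2 * \<Phi> n \<le> (\<gamma> n)\<^sup>2 * \<Phi> 0" for n
    by (intro mult_left_mono) auto
  moreover have "(\<gamma> n)\<^sup>2 * \<Phi> n = (norm (x n - xbar))\<^sup>2 + \<gamma> n * (V n / \<sigma> n)" for n
    using \<gamma>_pos[of n] \<sigma>_pos[of n] by (simp add: \<Phi>_def distrib_left power2_eq_square)
  ultimately show ?thesis
    by (simp add: \<Phi>_def V_def sum_divide_distrib)
qed

end
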